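(* Let $(X,A_X)$ and $(Y,A_Y)$ be compact dissimilarity networks, where $X$ and $Y$ are equipped with the forward-open topologies induced by $A_X$ and $A_Y$ respectively. Suppose at least one of the two networks is $\Psi$-controlled. Then $d_{\mathcal N}(X,Y)=0$ implies that $X$ and $Y$ are strongly isomorphic.
   Context: A network is a pair $(X,\omega_X)$ with $X$ a first countable topological space and $\omega_X:X\times X\to\mathbb R$ continuous; it is compact if $X$ is compact. A dissimilarity network is a network $(X,A_X)$ with $A_X:X\times X\to\mathbb R_{\ge0}$ and $A_X(x,x')=0$ iff $x=x'$ (no symmetry or triangle inequality assumed). The forward-open topology induced by $A_X$ is generated by the balls $B^+(x,r)=\{x'\in X:A_X(x,x')<r\}$, $x\in X$, $r>0$. A dissimilarity network $(X,A_X)$ is $\Psi$-controlled if there is a continuous $\Psi:\mathbb R_{\ge0}\times\mathbb R_{\ge0}\to\mathbb R_{\ge0}$ with $\Psi(0,0)=0$ and $A_X(x,x')\le\Psi(A_X(x,x''),A_X(x',x''))$ for all $x,x',x''\in X$. Strong isomorphism means existence of a bijection $\varphi:X\to Y$ with $A_Y(\varphi(x),\varphi(x'))=A_X(x,x')$ for all $x,x'$. A correspondence is a relation $R\subseteq X\times Y$ with surjective projections; $\mathrm{dis}(R)=\sup_{(x,y),(x',y')\in R}|A_X(x,x')-A_Y(y,y')|$; $d_{\mathcal N}(X,Y)=\tfrac12\inf_R\mathrm{dis}(R)$. *)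

theory Defs
  imports "HOL-Analysis.Analysis"
begin

text \<open>
  The underlying set of a network is the \<^const>\<open>topspace\<close> of an abstract topology, so that it need
  not be a whole type; weight functions only matter on this carrier.
\<close>

definition network :: "'a topology \<Rightarrow> ('a \<Rightarrow> 'a \<Rightarrow> real) \<Rightarrow> bool" where
  "network X \<omega> \<longleftrightarrow>
     first_countable X \<and> continuous_map (prod_topology X X) euclideanreal (\<lambda>(x, x'). \<omega> x x')"

definition dissimilarity_network :: "'a topology \<Rightarrow> ('a \<Rightarrow> 'a \<Rightarrow> real) \<Rightarrow> bool" where
  "dissimilarity_network X A \<longleftrightarrow>
     network X A \<and>
     (\<forall>x\<in>topspace X. \<forall>x'\<in>topspace X. 0 \<le> A x x' \<and> (A x x' = 0 \<longleftrightarrow> x = x'))"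

definition forward_ball :: "'a set \<Rightarrow> ('a \<Rightarrow> 'a \<Rightarrow> real) \<Rightarrow> 'a \<Rightarrow> real \<Rightarrow> 'a set" where
  "forward_ball S A x r = {x' \<in> S. A x x' < r}"

definition forward_open_topology :: "'a set \<Rightarrow> ('a \<Rightarrow> 'a \<Rightarrow> real) \<Rightarrow> 'a topology" where
  "forward_open_topology S A =
     topology_generated_by {forward_ball S A x r | x r. x \<in> S \<and> 0 < r}"

definition Psi_controlled :: "'a set \<Rightarrow> ('a \<Rightarrow> 'a \<Rightarrow> real) \<Rightarrow> bool" where
  "Psi_controlled S A \<longleftrightarrow>
     (\<exists>\<Psi> :: real \<times> real \<Rightarrow> real.
        continuous_on ({0..} \<times> {0..}) \<Psi> \<and> \<Psi> \<in> {0..} \<times> {0..} \<rightarrow> {0..} \<and> \<Psi> (0, 0) = 0 \<and>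
        (\<forall>x\<in>S. \<forall>x'\<in>S. \<forall>x''\<in>S. A x x' \<le> \<Psi> (A x x'', A x' x'')))"

definition strongly_isomorphic ::
    "'a set \<Rightarrow> ('a \<Rightarrow> 'a \<Rightarrow> real) \<Rightarrow> 'b set \<Rightarrow> ('b \<Rightarrow> 'b \<Rightarrow> real) \<Rightarrow> bool" where
  "strongly_isomorphic S A T B \<longleftrightarrow>
     (\<exists>\<phi>. bij_betw \<phi> S T \<and> (\<forall>x\<in>S. \<forall>x'\<in>S. B (\<phi> x) (\<phi> x') = A x x'))"

definition correspondence :: "'a set \<Rightarrow> 'b set \<Rightarrow> ('a \<times> 'b) set \<Rightarrow> bool" where
  "correspondence S T R \<longleftrightarrow> R \<subseteq> S \<times> T \<and> fst ` R = S \<and> snd ` R = T"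

text \<open>
  Suprema and infima are taken in the extended nonnegative reals: an unbounded distortion is
  infinite, the distortion of the empty relation is zero, and the distance is infinite if there is
  no correspondence (i.e. if exactly one of the carriers is empty).
\<close>

definition distortion ::
    "('a \<Rightarrow> 'a \<Rightarrow> real) \<Rightarrow> ('b \<Rightarrow> 'b \<Rightarrow> real) \<Rightarrow> ('a \<times> 'b) set \<Rightarrow> ennreal" where
  "distortion A B R = (SUP (x, y)\<in>R. SUP (x', y')\<in>R. ennreal \<bar>A x x' - B y y'\<bar>)"

definition network_dist ::
    "'a set \<Rightarrow> ('a \<Rightarrow> 'a \<Rightarrow> real) \<Rightarrow> 'b set \<Rightarrow> ('b \<Rightarrow> 'b \<Rightarrow> real) \<Rightarrow> ennreal" where
  "network_dist S A T B = (1 / 2) * (INF R\<in>{R. correspondence S T R}. distortion A B R)"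

end

theory Submission
  imports Defs
begin

text \<open>
  For every \<open>n\<close>, a correspondence of distortion at most \<open>1/n\<close> contains the graphs of a map
  \<open>f\<^sub>n : X \<rightarrow> Y\<close> and of the converse of a map \<open>g\<^sub>n : Y \<rightarrow> X\<close>. By Tychonoff's theorem the pairs
  \<open>(f\<^sub>n, g\<^sub>n)\<close> have a cluster point \<open>(\<phi>, \<psi>)\<close> for pointwise convergence, and by continuity of the weights
  \<open>A\<^sub>Y(\<phi> x, \<phi> x') = A\<^sub>X(x, x')\<close> and \<open>A\<^sub>X(\<psi> y, x) = A\<^sub>Y(y, \<phi> x)\<close>. The first identity makes \<open>\<phi>\<close>
  injective; the second one at \<open>x = \<psi> y\<close> gives \<open>\<phi> (\<psi> y) = y\<close>.
\<close>

text \<open>The infimum in \<open>network_dist\<close> need not be attained, so distance zero is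
  used only through correspondences of arbitrarily small positive distortion.\<close>

lemma correspondence_small_distortion:
  assumes "network_dist S A T B = 0" and "0 < e"
  obtains R where "correspondence S T R"
    and "\<And>x y x' y'. (x, y) \<in> R \<Longrightarrow> (x', y') \<in> R \<Longrightarrow> \<bar>A x x' - B y y'\<bar> \<le> e"
proof -
  have "(INF R\<in>{R. correspondence S T R}. distortion A B R) = 0"
    using assms(1) unfolding network_dist_def by (simp add: ennreal_divide_eq_0_iff)
  then have "(INF R\<in>{R. correspondence S T R}. distortion A B R) < ennreal e"
    using assms(2) by simp
  then obtain R where R: "correspondence S T R" "distortion A B R < ennreal e"
    unfolding INF_less_iff by blast
  have "\<bar>A x x' - B y y'\<bar> \<le> e" if "(x, y) \<in> R" "(x', y') \<in> R" for x y x' y'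
  proof -
    have "ennreal \<bar>A x x' - B y y'\<bar> \<le> (SUP (x', y')\<in>R. ennreal \<bar>A x x' - B y y'\<bar>)"
      by (rule SUP_upper2[OF that(2)]) simp
    also have "\<dots> \<le> distortion A B R"
      unfolding distortion_def by (rule SUP_upper2[OF that(1)]) simp
    finally show ?thesis
      using R(2) assms(2) by (metis ennreal_le_iff le_less_trans less_imp_le)
  qed
  with R(1) show thesis by (rule that)
qed

lemma closedin_Collect_Ball:
  assumes "\<And>i. i \<in> I \<Longrightarrow> closedin Z {z \<in> topspace Z. P i z}"
  shows "closedin Z {z \<in> topspace Z. \<forall>i\<in>I. P i z}"
proof -
  \<comment> \<open>Inserting \<open>topspace Z\<close> keeps the intersected family nonempty when
    \<open>I\<close> is empty.\<close>
  have "closedin Z (\<Inter> (insert (topspace Z) ((\<lambda>i. {z \<in> topspace Z. P i z}) ` I)))"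
    by (rule closedin_Inter) (use assms in auto)
  moreover have "\<Inter> (insert (topspace Z) ((\<lambda>i. {z \<in> topspace Z. P i z}) ` I)) =
      {z \<in> topspace Z. \<forall>i\<in>I. P i z}"
    by auto
  ultimately show ?thesis by simp
qed

lemma closedin_Collect_abs_le:
  assumes "continuous_map Z euclideanreal f"
  shows "closedin Z {z \<in> topspace Z. \<bar>f z\<bar> \<le> e}"
  using closedin_continuous_map_preimage[OF continuous_map_real_abs[OF assms], of "{..e}"] by simp

lemma continuous_map_network_weight:
  assumes "network X \<omega>" and "continuous_map Z X f" and "continuous_map Z X g"
  shows "continuous_map Z euclideanreal (\<lambda>z. \<omega> (f z) (g z))"
  using continuous_map_compose[OF continuous_map_pairedI[OF assms(2,3)]] assms(1)
  by (fastforce simp: network_def o_def)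

theorem mainTheorem5:
  fixes X :: "'a topology" and A\<^sub>X :: "'a \<Rightarrow> 'a \<Rightarrow> real"
    and Y :: "'b topology" and A\<^sub>Y :: "'b \<Rightarrow> 'b \<Rightarrow> real"
  assumes "dissimilarity_network X A\<^sub>X" and "compact_space X"
    and "dissimilarity_network Y A\<^sub>Y" and "compact_space Y"
    and "X = forward_open_topology (topspace X) A\<^sub>X"
    and "Y = forward_open_topology (topspace Y) A\<^sub>Y"
    and "Psi_controlled (topspace X) A\<^sub>X \<or> Psi_controlled (topspace Y) A\<^sub>Y"
    and "network_dist (topspace X) A\<^sub>X (topspace Y) A\<^sub>Y = 0"
  shows "strongly_isomorphic (topspace X) A\<^sub>X (topspace Y) A\<^sub>Y"
proof -
  define S T where "S = topspace X" and "T = topspace Y"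
  have netX: "network X A\<^sub>X" and netY: "network Y A\<^sub>Y"
    and zeroX: "\<And>x x'. x \<in> S \<Longrightarrow> x' \<in> S \<Longrightarrow> A\<^sub>X x x' = 0 \<longleftrightarrow> x = x'"
    and zeroY: "\<And>y y'. y \<in> T \<Longrightarrow> y' \<in> T \<Longrightarrow> A\<^sub>Y y y' = 0 \<longleftrightarrow> y = y'"
    using assms(1,3) by (auto simp: dissimilarity_network_def S_def T_def)
  \<comment> \<open>Both maps live in one compact space, so that a single limiting argument yields
    \<open>\<phi>\<close> and \<open>\<psi>\<close> together and keeps the relation between
    them.\<close>
  define Z where "Z = prod_topology (product_topology (\<lambda>_. Y) S) (product_topology (\<lambda>_. X) T)"
  have compactZ: "compact_space Z"
    unfolding Z_def using assms(2,4)
    by (simp add: compact_space_prod_topology compact_space_product_topology)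
  have topZ: "topspace Z = (S \<rightarrow>\<^sub>E T) \<times> (T \<rightarrow>\<^sub>E S)"
    by (simp add: Z_def S_def T_def)
  have evalX: "continuous_map Z Y (\<lambda>z. fst z x)" if "x \<in> S" for x
    using continuous_map_compose[OF continuous_map_fst continuous_map_product_projection[OF that]]
    by (simp add: Z_def o_def)
  have evalY: "continuous_map Z X (\<lambda>z. snd z y)" if "y \<in> T" for y
    using continuous_map_compose[OF continuous_map_snd continuous_map_product_projection[OF that]]
    by (simp add: Z_def o_def)
  define P where "P e = {z \<in> topspace Z. \<forall>x\<in>S. \<forall>x'\<in>S.
      \<bar>A\<^sub>Y (fst z x) (fst z x') - A\<^sub>X x x'\<bar> \<le> e}" for e
  define Q where "Q e = {z \<in> topspace Z. \<forall>y\<in>T. \<forall>x\<in>S.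
      \<bar>A\<^sub>X (snd z y) x - A\<^sub>Y y (fst z x)\<bar> \<le> e}" for e
  define C where "C n = P (inverse (real (Suc n))) \<inter> Q (inverse (real (Suc n)))" for n
  \<comment> \<open>Each inequality in \<open>P\<close> and \<open>Q\<close> bounds a function of
    \<open>z\<close> that is continuous because it depends on \<open>z\<close> only through two
    evaluations.\<close>
  have "closedin Z (C n)" for n
    unfolding C_def P_def Q_def
    by (intro closedin_Int closedin_Collect_Ball closedin_Collect_abs_le continuous_map_diff
        continuous_map_network_weight[OF netX] continuous_map_network_weight[OF netY]
        evalX evalY) (auto simp: S_def T_def)
  moreover have "C n \<noteq> {}" for n
  proof -
    define e where "e = inverse (real (Suc n))"
    have "0 < e" by (simp add: e_def)
    obtain R where R: "correspondence S T R"
      and dis: "\<And>x y x' y'. (x, y) \<in> R \<Longrightarrow> (x', y') \<in> R \<Longrightarrow> \<bar>A\<^sub>X x x' - A\<^sub>Y y y'\<bar> \<le> e"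
      using correspondence_small_distortion[OF assms(8) \<open>0 < e\<close>] unfolding S_def T_def by metis
    have "\<forall>x\<in>S. \<exists>y. (x, y) \<in> R" "\<forall>y\<in>T. \<exists>x. (x, y) \<in> R" and RST: "R \<subseteq> S \<times> T"
      using R by (force simp: correspondence_def)+
    then obtain f g where f: "\<And>x. x \<in> S \<Longrightarrow> (x, f x) \<in> R" and g: "\<And>y. y \<in> T \<Longrightarrow> (g y, y) \<in> R"
      by metis
    \<comment> \<open>Restriction gives the extensional functions that form
      \<open>topspace Z\<close>. The bound in \<open>Q\<close> compares \<open>(g y, y)\<close> with
      \<open>(x, f x)\<close>, which is possible because \<open>f\<close> and \<open>g\<close> come
      from the same \<open>R\<close>.\<close>
    have "(restrict f S, restrict g T) \<in> P e \<inter> Q e"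
      using RST f g dis by (force simp: P_def Q_def topZ abs_minus_commute)
    then show ?thesis by (auto simp: C_def e_def)
  qed
  moreover have "decseq C"
  proof (rule decseq_SucI)
    fix n
    have "inverse (real (Suc (Suc n))) \<le> inverse (real (Suc n))" by simp
    then show "C (Suc n) \<subseteq> C n"
      unfolding C_def P_def Q_def by (blast intro: order_trans)
  qed
  \<comment> \<open>A decreasing sequence of nonempty closed sets in a compact space has a common
    point; this is the cluster point.\<close>
  ultimately have "(\<Inter>n. C n) \<noteq> {}"
    using compact_space_imp_nest[OF compactZ] by blast
  then obtain \<phi> \<psi> where mem: "(\<phi>, \<psi>) \<in> C n" for n
    by auto
  have limit: "a = b" if "\<And>n. \<bar>a - b\<bar> \<le> inverse (real (Suc n))" for a b :: real
    using that reals_Archimedean[of "\<bar>a - b\<bar>"] by (metis abs_le_zero_iff not_le right_minus_eq)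
  have pres: "A\<^sub>Y (\<phi> x) (\<phi> x') = A\<^sub>X x x'" if "x \<in> S" "x' \<in> S" for x x'
    using mem that by (intro limit) (auto simp: C_def P_def)
  have adj: "A\<^sub>X (\<psi> y) x = A\<^sub>Y y (\<phi> x)" if "y \<in> T" "x \<in> S" for x y
    using mem that by (intro limit) (auto simp: C_def Q_def)
  have \<phi>: "\<phi> \<in> S \<rightarrow> T" and \<psi>: "\<psi> \<in> T \<rightarrow> S"
    using mem[of 0] by (auto simp: C_def P_def topZ)
  \<comment> \<open>At \<open>x = \<psi> y\<close> the left side of \<open>adj\<close> lies on the
    diagonal, hence is zero, and \<open>zeroY\<close> applies to the right side.\<close>
  have "\<phi> (\<psi> y) = y" if "y \<in> T" for y
    using adj[of y "\<psi> y"] that \<phi> \<psi> zeroX zeroY by (metis PiE)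
  then have "\<phi> ` S = T"
    using \<phi> \<psi> by (force simp: image_iff)
  \<comment> \<open>If \<open>\<phi> x = \<phi> x'\<close>, then applying \<open>pres\<close> twice
    gives \<open>A\<^sub>X x x' = A\<^sub>X x x\<close>, which is zero.\<close>
  moreover have "inj_on \<phi> S"
    using pres zeroX by (metis inj_onI)
  ultimately show ?thesis
    unfolding strongly_isomorphic_def bij_betw_def S_def[symmetric] T_def[symmetric]
    using pres by blast
qed

end
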